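(* Let $G$ and $H$ be countable, discrete, sofic groups. Then the wreath product $G\wr H$ is sofic.
   Context: For a finite (nonempty) set $A$, the normalized Hamming distance on $\mathrm{Sym}(A)$ is $d_{\mathrm{Hamm}}(\sigma,\tau)=\frac{1}{|A|}|\{a\in A:\sigma(a)\neq\tau(a)\}|$. Let $\Gamma$ be a countable discrete group, $F\subseteq \Gamma$ finite, $\varepsilon>0$, and $A$ a finite set. A function $\sigma\colon \Gamma\to\mathrm{Sym}(A)$ (not assumed to be a homomorphism) is: - $(F,\varepsilon)$-multiplicative if $\max_{g,h\in F} d_{\mathrm{Hamm}}(\sigma(g)\sigma(h),\sigma(gh))<\varepsilon$; - $(F,\varepsilon)$-free if $\min_{g\in F\setminus\{1\}} d_{\mathrm{Hamm}}(\sigma(g),\mathrm{Id})>1-\varepsilon$; - an $(F,\varepsilon)$-sofic approximation if it is $(F,\varepsilon)$-multiplicative, $(F,\varepsilon)$-free, and $\sigma(1)=\mathrm{Id}$. The group $\Gamma$ is sofic if for every finite $F\subseteq\Gamma$ and every $\varepsilon>0$ there are a finite set $A$ and an $(F,\varepsilon)$-sofic approximation $\sigma\colon\Gamma\to\mathrm{Sym}(A)$. The wreath product is $G\wr H=\left(\bigoplus_{H}G\right)\rtimes H$, where $\bigoplus_H G$ is the group of finitely supported families $(g_x)_{x\in H}$ in $G$, and $h\in H$ acts by the automorphism $\alpha_h\big((g_x)_{x\in H}\big)=(g_{h^{-1}x})_{x\in H}$. *)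

theory Defs
  imports Complex_Main "HOL-Library.Countable_Set" "HOL-Combinatorics.Permutations"
    "HOL-Algebra.Product_Groups"
begin

section \<open>Sofic groups\<close>

definition hamming_dist :: "'a set \<Rightarrow> ('a \<Rightarrow> 'a) \<Rightarrow> ('a \<Rightarrow> 'a) \<Rightarrow> real" where
  "hamming_dist A s t = real (card {a \<in> A. s a \<noteq> t a}) / real (card A)"

text \<open>
  An element of Sym(A) is a function \<open>s\<close> with \<open>s permutes A\<close> (identity outside of \<open>A\<close>).
  In the following, \<open>F\<close> ranges over finite sets, so that requiring a strict bound for every
  element is the same as requiring it for the maximum or minimum; a maximum or minimum over
  an empty index set imposes no condition.
\<close>

definition multiplicative ::
  "('g, 'm) monoid_scheme \<Rightarrow> 'g set \<Rightarrow> real \<Rightarrow> 'a set \<Rightarrow> ('g \<Rightarrow> 'a \<Rightarrow> 'a) \<Rightarrow> bool" where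
  "multiplicative \<Gamma> F \<epsilon> A \<sigma> \<longleftrightarrow>
     (\<forall>g\<in>F. \<forall>h\<in>F. hamming_dist A (\<sigma> g \<circ> \<sigma> h) (\<sigma> (g \<otimes>\<^bsub>\<Gamma>\<^esub> h)) < \<epsilon>)"

definition almost_free ::
  "('g, 'm) monoid_scheme \<Rightarrow> 'g set \<Rightarrow> real \<Rightarrow> 'a set \<Rightarrow> ('g \<Rightarrow> 'a \<Rightarrow> 'a) \<Rightarrow> bool" where
  "almost_free \<Gamma> F \<epsilon> A \<sigma> \<longleftrightarrow> (\<forall>g\<in>F - {\<one>\<^bsub>\<Gamma>\<^esub>}. hamming_dist A (\<sigma> g) id > 1 - \<epsilon>)"

definition sofic_approximation ::
  "('g, 'm) monoid_scheme \<Rightarrow> 'g set \<Rightarrow> real \<Rightarrow> 'a set \<Rightarrow> ('g \<Rightarrow> 'a \<Rightarrow> 'a) \<Rightarrow> bool" where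
  "sofic_approximation \<Gamma> F \<epsilon> A \<sigma> \<longleftrightarrow>
     (\<forall>g\<in>carrier \<Gamma>. \<sigma> g permutes A) \<and>
     multiplicative \<Gamma> F \<epsilon> A \<sigma> \<and> almost_free \<Gamma> F \<epsilon> A \<sigma> \<and> \<sigma> \<one>\<^bsub>\<Gamma>\<^esub> = id"

text \<open>
  The finite set \<open>A\<close> is taken inside \<open>nat\<close>, because one cannot quantify over types; by the lemma
  \<open>soficI\<close> below, finite sets of any other type may be used equally well.
\<close>

definition sofic :: "('g, 'm) monoid_scheme \<Rightarrow> bool" where
  "sofic \<Gamma> \<longleftrightarrow>
     (\<forall>F \<epsilon>. finite F \<and> F \<subseteq> carrier \<Gamma> \<and> \<epsilon> > 0 \<longrightarrow>
        (\<exists>(A :: nat set) \<sigma>. finite A \<and> A \<noteq> {} \<and> sofic_approximation \<Gamma> F \<epsilon> A \<sigma>))"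

lemma sofic_approximation_transport:
  fixes \<Gamma> (structure)
  assumes \<Gamma>: "group \<Gamma>" and F: "F \<subseteq> carrier \<Gamma>"
    and s: "sofic_approximation \<Gamma> F \<epsilon> A \<sigma>" and f: "bij_betw f A B"
  shows "\<exists>\<tau>. sofic_approximation \<Gamma> F \<epsilon> B \<tau>"
proof -
  interpret group \<Gamma> by (rule \<Gamma>)
  define f' where "f' = inv_into A f"
  define \<tau> where "\<tau> g b = (if b \<in> B then f (\<sigma> g (f' b)) else b)" for g b
  have perm: "\<sigma> g permutes A" if "g \<in> carrier \<Gamma>" for g
    using s that by (simp add: sofic_approximation_def)
  have f': "bij_betw f' B A"
    unfolding f'_def using f by (rule bij_betw_inv_into)
  have ff': "f (f' b) = b" if "b \<in> B" for b
    using f that unfolding f'_def by (rule bij_betw_inv_into_right)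
  have f'f: "f' (f a) = a" if "a \<in> A" for a
    using f that unfolding f'_def by (rule bij_betw_inv_into_left)
  have fB: "f a \<in> B" if "a \<in> A" for a
    using f that by (auto simp: bij_betw_def)
  have f'A: "f' b \<in> A" if "b \<in> B" for b
    using f' that by (auto simp: bij_betw_def)
  have tau_f: "\<tau> g (f a) = f (\<sigma> g a)" if "a \<in> A" for g a
    using that by (simp add: \<tau>_def fB f'f)
  have f_eq: "f x = f y \<longleftrightarrow> x = y" if "x \<in> A" "y \<in> A" for x y
    using that f'f by metis
  have sA: "\<sigma> g a \<in> A" if "a \<in> A" "g \<in> carrier \<Gamma>" for g a
    using perm that by (simp add: permutes_in_image)
  have ham: "hamming_dist B s' t' = hamming_dist A s t"
    if st: "\<And>a. a \<in> A \<Longrightarrow> s' (f a) = f (s a)" "\<And>a. a \<in> A \<Longrightarrow> t' (f a) = f (t a)"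
      "\<And>a. a \<in> A \<Longrightarrow> s a \<in> A" "\<And>a. a \<in> A \<Longrightarrow> t a \<in> A" for s' t' s t
  proof -
    have eq: "s' b = f (s (f' b))" "t' b = f (t (f' b))" if "b \<in> B" for b
      using st(1,2)[OF f'A[OF that]] ff'[OF that] by simp_all
    have "bij_betw f {a \<in> A. s a \<noteq> t a} {b \<in> B. s' b \<noteq> t' b}"
      by (rule bij_betwI[where g = f']) (auto simp: st fB f'A ff' f'f f_eq eq)
    then show ?thesis
      using f by (simp add: hamming_dist_def bij_betw_same_card)
  qed
  have "\<tau> g permutes B" if "g \<in> carrier \<Gamma>" for g
  proof (rule bij_imp_permutes)
    have "bij_betw (f \<circ> (\<sigma> g \<circ> f')) B B"
      using f f' permutes_imp_bij[OF perm[OF that]] by (blast intro: bij_betw_trans)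
    then show "bij_betw (\<tau> g) B B"
      by (rule iffD1[OF bij_betw_cong, rotated]) (simp add: \<tau>_def)
  qed (simp add: \<tau>_def)
  moreover have "multiplicative \<Gamma> F \<epsilon> B \<tau>"
    unfolding multiplicative_def
  proof (intro ballI)
    fix g h assume gh: "g \<in> F" "h \<in> F"
    then have [simp]: "g \<in> carrier \<Gamma>" "h \<in> carrier \<Gamma>" using F by auto
    have "hamming_dist B (\<tau> g \<circ> \<tau> h) (\<tau> (g \<otimes> h)) = hamming_dist A (\<sigma> g \<circ> \<sigma> h) (\<sigma> (g \<otimes> h))"
      by (rule ham) (auto simp: tau_f sA)
    then show "hamming_dist B (\<tau> g \<circ> \<tau> h) (\<tau> (g \<otimes> h)) < \<epsilon>"
      using s gh by (simp add: sofic_approximation_def multiplicative_def)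
  qed
  moreover have "almost_free \<Gamma> F \<epsilon> B \<tau>"
    unfolding almost_free_def
  proof (intro ballI)
    fix g assume g: "g \<in> F - {\<one>}"
    then have [simp]: "g \<in> carrier \<Gamma>" using F by auto
    have "hamming_dist B (\<tau> g) id = hamming_dist A (\<sigma> g) id"
      by (rule ham) (auto simp: tau_f sA)
    then show "hamming_dist B (\<tau> g) id > 1 - \<epsilon>"
      using s g by (simp add: sofic_approximation_def almost_free_def)
  qed
  moreover have "\<tau> \<one> = id"
    using s by (auto simp: sofic_approximation_def \<tau>_def ff')
  ultimately show ?thesis
    unfolding sofic_approximation_def by blast
qed

lemma soficI:
  assumes "group \<Gamma>"
    and ex: "\<And>F \<epsilon>. finite F \<Longrightarrow> F \<subseteq> carrier \<Gamma> \<Longrightarrow> \<epsilon> > 0 \<Longrightarrow>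
      \<exists>(A :: 'a set) \<sigma>. finite A \<and> A \<noteq> {} \<and> sofic_approximation \<Gamma> F \<epsilon> A \<sigma>"
  shows "sofic \<Gamma>"
  unfolding sofic_def
proof (intro allI impI, elim conjE)
  fix F \<epsilon> assume F: "finite F" "F \<subseteq> carrier \<Gamma>" and "(\<epsilon>::real) > 0"
  then obtain A :: "'a set" and \<sigma> where A: "finite A" "A \<noteq> {}" "sofic_approximation \<Gamma> F \<epsilon> A \<sigma>"
    using ex by meson
  obtain f where f: "bij_betw f A {0..<card A}"
    using A(1) ex_bij_betw_finite_nat by blast
  with sofic_approximation_transport[OF assms(1) F(2) A(3)]
  obtain \<tau> where "sofic_approximation \<Gamma> F \<epsilon> {0..<card A} \<tau>" by blast
  moreover have "{0..<card A} \<noteq> {}" using A by (simp add: card_gt_0_iff)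
  ultimately show "\<exists>(A :: nat set) \<sigma>. finite A \<and> A \<noteq> {} \<and> sofic_approximation \<Gamma> F \<epsilon> A \<sigma>"
    by blast
qed


section \<open>Wreath products\<close>

definition semidirect_product ::
  "('n, 'k) monoid_scheme \<Rightarrow> ('h, 'm) monoid_scheme \<Rightarrow> ('h \<Rightarrow> 'n \<Rightarrow> 'n) \<Rightarrow> ('n \<times> 'h) monoid" where
  "semidirect_product N H \<alpha> =
     \<lparr>carrier = carrier N \<times> carrier H,
      monoid.mult = (\<lambda>(n, h) (n', h'). (n \<otimes>\<^bsub>N\<^esub> \<alpha> h n', h \<otimes>\<^bsub>H\<^esub> h')),
      one = (\<one>\<^bsub>N\<^esub>, \<one>\<^bsub>H\<^esub>)\<rparr>"

definition shift_action :: "('h, 'm) monoid_scheme \<Rightarrow> 'h \<Rightarrow> ('h \<Rightarrow> 'g) \<Rightarrow> 'h \<Rightarrow> 'g" where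
  "shift_action H h f = (\<lambda>x\<in>carrier H. f (inv\<^bsub>H\<^esub> h \<otimes>\<^bsub>H\<^esub> x))"

text \<open>
  The library's \<open>sum_group\<close> is the restricted direct product: its elements are the extensional
  families with finite support, multiplied pointwise (see \<open>carrier_sum_group\<close>, \<open>mult_sum_group\<close>).
\<close>

definition wreath_product ::
  "('g, 'k) monoid_scheme \<Rightarrow> ('h, 'm) monoid_scheme \<Rightarrow> (('h \<Rightarrow> 'g) \<times> 'h) monoid" where
  "wreath_product G H =
     semidirect_product (sum_group (carrier H) (\<lambda>_. G)) H (shift_action H)"

lemma group_semidirect_product:
  assumes N: "group N" and H: "group H"
    and hom: "\<And>h. h \<in> carrier H \<Longrightarrow> \<alpha> h \<in> hom N N"
    and act: "\<And>h h' n. h \<in> carrier H \<Longrightarrow> h' \<in> carrier H \<Longrightarrow> n \<in> carrier N \<Longrightarrow>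
      \<alpha> (h \<otimes>\<^bsub>H\<^esub> h') n = \<alpha> h (\<alpha> h' n)"
    and one: "\<And>n. n \<in> carrier N \<Longrightarrow> \<alpha> \<one>\<^bsub>H\<^esub> n = n"
  shows "group (semidirect_product N H \<alpha>)"
proof -
  interpret N: group N by (rule N)
  interpret H: group H by (rule H)
  have cl: "\<alpha> h n \<in> carrier N" if "h \<in> carrier H" "n \<in> carrier N" for h n
    using hom that by (auto simp: hom_def)
  have mult: "\<alpha> h (n \<otimes>\<^bsub>N\<^esub> n') = \<alpha> h n \<otimes>\<^bsub>N\<^esub> \<alpha> h n'"
    if "h \<in> carrier H" "n \<in> carrier N" "n' \<in> carrier N" for h n n'
    using hom that by (auto simp: hom_def)
  have inv: "\<exists>y\<in>carrier N \<times> carrier H.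
      (fst y \<otimes>\<^bsub>N\<^esub> \<alpha> (snd y) n, snd y \<otimes>\<^bsub>H\<^esub> h) = (\<one>\<^bsub>N\<^esub>, \<one>\<^bsub>H\<^esub>)"
    if "n \<in> carrier N" "h \<in> carrier H" for n h
    using that by (intro bexI[of _ "(inv\<^bsub>N\<^esub> (\<alpha> (inv\<^bsub>H\<^esub> h) n), inv\<^bsub>H\<^esub> h)"]) (auto simp: cl)
  show ?thesis
    by (rule groupI)
      (use inv in \<open>auto simp: semidirect_product_def cl mult act one N.m_assoc H.m_assoc
        case_prod_unfold\<close>)
qed

lemma shift_action_closed:
  assumes G: "group G" and H: "group H"
    and h: "h \<in> carrier H" and f: "f \<in> carrier (sum_group (carrier H) (\<lambda>_. G))"
  shows "shift_action H h f \<in> carrier (sum_group (carrier H) (\<lambda>_. G))"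
proof -
  interpret H: group H by (rule H)
  let ?S = "{x \<in> carrier H. f x \<noteq> \<one>\<^bsub>G\<^esub>}"
  have "{x \<in> carrier H. f (inv\<^bsub>H\<^esub> h \<otimes>\<^bsub>H\<^esub> x) \<noteq> \<one>\<^bsub>G\<^esub>} \<subseteq> (\<lambda>x. h \<otimes>\<^bsub>H\<^esub> x) ` ?S"
  proof
    fix x assume x: "x \<in> {x \<in> carrier H. f (inv\<^bsub>H\<^esub> h \<otimes>\<^bsub>H\<^esub> x) \<noteq> \<one>\<^bsub>G\<^esub>}"
    with h show "x \<in> (\<lambda>x. h \<otimes>\<^bsub>H\<^esub> x) ` ?S"
      by (intro image_eqI[of _ _ "inv\<^bsub>H\<^esub> h \<otimes>\<^bsub>H\<^esub> x"]) (auto simp: H.m_assoc[symmetric])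
  qed
  moreover have "finite ?S"
    using f by (simp add: carrier_sum_group G)
  ultimately have "finite {x \<in> carrier H. f (inv\<^bsub>H\<^esub> h \<otimes>\<^bsub>H\<^esub> x) \<noteq> \<one>\<^bsub>G\<^esub>}"
    using finite_surj by blast
  then show ?thesis
    using f h by (auto simp: carrier_sum_group G shift_action_def PiE_iff cong: conj_cong)
qed

lemma group_wreath_product:
  assumes G: "group G" and H: "group H"
  shows "group (wreath_product G H)"
  unfolding wreath_product_def
proof (rule group_semidirect_product)
  interpret G: group G by (rule G)
  interpret H: group H by (rule H)
  let ?N = "sum_group (carrier H) (\<lambda>_. G)"
  show "group ?N" by (simp add: G)
  show "group H" by (rule H)
  show "shift_action H h \<in> hom ?N ?N" if "h \<in> carrier H" for h
    using that by (auto simp: hom_def shift_action_closed[OF G H]) (auto simp: shift_action_def)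
  show "shift_action H (h \<otimes>\<^bsub>H\<^esub> h') f = shift_action H h (shift_action H h' f)"
    if "h \<in> carrier H" "h' \<in> carrier H" "f \<in> carrier ?N" for h h' f
    using that by (auto simp: shift_action_def H.inv_mult_group H.m_assoc)
  show "shift_action H \<one>\<^bsub>H\<^esub> f = f" if "f \<in> carrier ?N" for f
    using that by (auto simp: shift_action_def carrier_sum_group G PiE_iff extensional_def)
qed

lemma countable_wreath_product:
  assumes G: "group G" and cG: "countable (carrier G)" and cH: "countable (carrier H)"
  shows "countable (carrier (wreath_product G H))"
proof -
  let ?N = "carrier (sum_group (carrier H) (\<lambda>_. G))"
  define gr where "gr f = (\<lambda>x. (x, f x)) ` {x \<in> carrier H. f x \<noteq> \<one>\<^bsub>G\<^esub>}" for f
  have "inj_on gr ?N"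
  proof (rule inj_onI)
    fix f f' assume f: "f \<in> ?N" "f' \<in> ?N" and eq: "gr f = gr f'"
    show "f = f'"
    proof (rule extensionalityI[of _ "carrier H"])
      show "f \<in> extensional (carrier H)" "f' \<in> extensional (carrier H)"
        using f by (auto simp: carrier_sum_group G PiE_iff)
      show "f x = f' x" if "x \<in> carrier H" for x
      proof -
        have "(x, y) \<in> gr k \<longleftrightarrow> k x \<noteq> \<one>\<^bsub>G\<^esub> \<and> y = k x" for y k
          using that by (auto simp: gr_def)
        then show ?thesis using eq by metis
      qed
    qed
  qed
  moreover have "countable (gr ` ?N)"
  proof (rule countable_subset)
    show "gr ` ?N \<subseteq> {A. finite A \<and> A \<subseteq> carrier H \<times> carrier G}"
      by (auto simp: gr_def carrier_sum_group G PiE_iff)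
    show "countable {A. finite A \<and> A \<subseteq> carrier H \<times> carrier G}"
      by (intro countable_Collect_finite_subset countable_SIGMA cG cH)
  qed
  ultimately have "countable ?N"
    by (rule countable_image_inj_on[rotated])
  then show ?thesis
    by (simp add: wreath_product_def semidirect_product_def cH)
qed

end

theory Submission
  imports Defs
begin

text \<open>
  Let \<open>s\<close> and \<open>t\<close> be sofic approximations of \<open>G\<close> on \<open>A\<close> and of \<open>H\<close> on \<open>B\<close>. The wreath product acts
  approximately on \<open>A\<^sup>B \<times> B\<close>, thought of as lamp configurations \<open>a\<close> together with the position \<open>b\<close>
  of a lamplighter: the element \<open>(f, h)\<close> moves the lamplighter to \<open>b' = t h b\<close>, and then, for each \<open>x\<close>
  in the support of \<open>f\<close>, applies \<open>s (f x)\<close> to the lamp at \<open>(t x)\<^sup>-\<^sup>1 b'\<close>. For most \<open>b'\<close> these lamps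
  are distinct and \<open>(t (h x))\<^sup>-\<^sup>1 (t h b) = (t x)\<^sup>-\<^sup>1 b\<close>, which reproduces the shift action. Only boundedly
  many lamps are touched from any position, so the errors of \<open>s\<close> add up to a bounded multiple.
\<close>

section \<open>Densities in finite sets\<close>

definition density :: "'a set \<Rightarrow> ('a \<Rightarrow> bool) \<Rightarrow> real" where
  "density A P = real (card {a \<in> A. P a}) / real (card A)"

lemma hamming_dist_density: "hamming_dist A s t = density A (\<lambda>a. s a \<noteq> t a)"
  by (simp add: hamming_dist_def density_def)

lemma density_mono:
  assumes "finite A" "\<And>a. a \<in> A \<Longrightarrow> P a \<Longrightarrow> Q a"
  shows "density A P \<le> density A Q"
  unfolding density_def using assms
  by (intro divide_right_mono of_nat_mono card_mono) auto

lemma density_disj: "density A (\<lambda>a. P a \<or> Q a) \<le> density A P + density A Q"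
proof -
  have "{a \<in> A. P a \<or> Q a} = {a \<in> A. P a} \<union> {a \<in> A. Q a}" by auto
  then have "card {a \<in> A. P a \<or> Q a} \<le> card {a \<in> A. P a} + card {a \<in> A. Q a}"
    by (simp add: card_Un_le)
  then show ?thesis
    unfolding density_def add_divide_distrib[symmetric]
    by (intro divide_right_mono) linarith+
qed

lemma density_Bex:
  assumes "finite I" and "\<And>i. i \<in> I \<Longrightarrow> density A (P i) \<le> e"
  shows "density A (\<lambda>a. \<exists>i\<in>I. P i a) \<le> real (card I) * e"
  using assms
proof (induction I rule: finite_induct)
  case empty
  then show ?case by (simp add: density_def)
next
  case (insert i I)
  have "density A (\<lambda>a. \<exists>j\<in>insert i I. P j a) \<le> density A (P i) + density A (\<lambda>a. \<exists>j\<in>I. P j a)"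
    using density_disj[of A "P i"] by simp
  also have "\<dots> \<le> e + real (card I) * e"
    using insert by (intro add_mono) auto
  finally show ?case
    using insert by (simp add: algebra_simps)
qed

lemma density_not:
  assumes "finite A" "A \<noteq> {}"
  shows "density A (\<lambda>a. \<not> P a) = 1 - density A P"
proof -
  have "{a \<in> A. \<not> P a} = A - {a \<in> A. P a}" by auto
  then have "real (card {a \<in> A. \<not> P a}) = real (card A) - real (card {a \<in> A. P a})"
    using assms by (simp add: card_Diff_subset card_mono of_nat_diff)
  then show ?thesis
    using assms by (simp add: density_def diff_divide_distrib)
qed

text \<open>Change of variable. It moves conditions on a later position back to the starting
  position, and trades a position \<open>b = t x c\<close> for the lamp \<open>c\<close>.\<close>

lemma density_permutes:
  assumes "s permutes A"
  shows "density A (\<lambda>a. P (s a)) = density A P"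
proof -
  have "bij_betw s {a \<in> A. P (s a)} {a \<in> A. P a}"
    by (rule bij_betwI[where g = "inv_into UNIV s"])
      (auto simp: permutes_in_image[OF assms] permutes_in_image[OF permutes_inv[OF assms]]
        permutes_inverses[OF assms])
  then show ?thesis
    by (simp add: density_def bij_betw_same_card)
qed

text \<open>One coordinate of a uniformly random configuration is uniform: the event is a box in
  which only the factor at \<open>c\<close> is restricted, and the other factors cancel in the
  quotient.\<close>

lemma density_PiE:
  assumes "finite A" "A \<noteq> {}" "finite B" "c \<in> B"
  shows "density (B \<rightarrow>\<^sub>E A) (\<lambda>a. P (a c)) = density A P"
proof -
  have "{a \<in> B \<rightarrow>\<^sub>E A. P (a c)} = (\<Pi>\<^sub>E i\<in>B. if i = c then {x \<in> A. P x} else A)"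
    using assms(4) by (auto simp: PiE_iff extensional_def split: if_splits)
  then have "card {a \<in> B \<rightarrow>\<^sub>E A. P (a c)} =
      (\<Prod>i\<in>B. if i = c then card {x \<in> A. P x} else card A)"
    using assms by (simp add: card_PiE if_distrib cong: if_cong)
  also have "\<dots> = card {x \<in> A. P x} * card A ^ (card B - 1)"
    using assms by (subst prod.remove[of _ c]) (simp_all add: prod.If_cases)
  moreover have "card (B \<rightarrow>\<^sub>E A) = card A * card A ^ (card B - 1)"
    using assms by (simp add: card_PiE power_eq_if)
      (metis card_gt_0_iff empty_iff)
  ultimately show ?thesis
    using assms by (simp add: density_def)
qed

text \<open>Counting over the fibres of the second coordinate: a bad \<open>y\<close> is charged its
  whole fibre, a good one only the fraction \<open>e\<close>. Later \<open>X\<close> consists of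
  configurations and \<open>Y\<close> of positions, so errors of \<open>t\<close> enter through
  \<open>Bad\<close> and errors of \<open>s\<close> through \<open>e\<close>.\<close>

lemma density_Times_le:
  assumes X: "finite X" "X \<noteq> {}" and Y: "finite Y" "Y \<noteq> {}" and e: "0 \<le> e"
    and le: "\<And>y. y \<in> Y \<Longrightarrow> \<not> Bad y \<Longrightarrow> density X (\<lambda>x. R (x, y)) \<le> e"
  shows "density (X \<times> Y) R \<le> density Y Bad + e"
proof -
  have pos: "card X > 0" "card Y > 0" using X Y by (auto simp: card_gt_0_iff)
  have "{z \<in> X \<times> Y. R z} = prod.swap ` (SIGMA y:Y. {x \<in> X. R (x, y)})"
    by (auto simp: image_iff)
  then have "card {z \<in> X \<times> Y. R z} = card (SIGMA y:Y. {x \<in> X. R (x, y)})"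
    by (simp add: card_image)
  also have "\<dots> = (\<Sum>y\<in>Y. card {x \<in> X. R (x, y)})"
    using X Y by (simp add: card_SigmaI)
  finally have "real (card {z \<in> X \<times> Y. R z}) = (\<Sum>y\<in>Y. real (card {x \<in> X. R (x, y)}))"
    by simp
  also have "\<dots> \<le> (\<Sum>y\<in>Y. (if Bad y then real (card X) else 0) + e * real (card X))"
  proof (rule sum_mono)
    fix y assume y: "y \<in> Y"
    have "card {x \<in> X. R (x, y)} \<le> card X" using X by (intro card_mono) auto
    moreover have "real (card {x \<in> X. R (x, y)}) \<le> e * real (card X)" if "\<not> Bad y"
      using le[OF y that] pos by (simp add: density_def divide_le_eq)
    ultimately show "real (card {x \<in> X. R (x, y)})
        \<le> (if Bad y then real (card X) else 0) + e * real (card X)"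
      using e by (cases "Bad y") (auto intro: add_increasing2)
  qed
  also have "\<dots> = real (card {y \<in> Y. Bad y}) * real (card X) + real (card Y) * (e * real (card X))"
    using Y by (simp add: sum.distrib sum.If_cases Int_def)
  finally have "real (card {z \<in> X \<times> Y. R z})
      \<le> (real (card {y \<in> Y. Bad y}) + real (card Y) * e) * real (card X)"
    by (simp add: algebra_simps)
  then have "density (X \<times> Y) R \<le>
      ((real (card {y \<in> Y. Bad y}) + real (card Y) * e) * real (card X)) / (real (card X) * real (card Y))"
    unfolding density_def card_cartesian_product of_nat_mult by (rule divide_right_mono) simp
  also have "\<dots> = density Y Bad + e"
    using pos by (simp add: density_def field_simps)
  finally show ?thesis .
qed

section \<open>The lamplighter action\<close>

text \<open>
  The finite sets \<open>L\<close> and \<open>K\<close> are those on which the approximations \<open>t\<close> of \<open>H\<close> and \<open>s\<close> of \<open>G\<close>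
  are controlled; \<open>E\<close> is the window in which lamps can be modified.
\<close>

locale wreath_approximation = G: group G + H: group H
  for G :: "('g, 'k) monoid_scheme" and H :: "('h, 'm) monoid_scheme" +
  fixes A :: "'a set" and B :: "'b set" and s t K L E and \<delta> :: real
  assumes A: "finite A" "A \<noteq> {}" and B: "finite B" "B \<noteq> {}"
    and s: "sofic_approximation G K \<delta> A s" and t: "sofic_approximation H L \<delta> B t"
    and E: "finite E" "E \<subseteq> carrier H" "E \<subseteq> L"
    and inv_E: "\<And>x. x \<in> E \<Longrightarrow> inv\<^bsub>H\<^esub> x \<in> L"
    and inv_E_E: "\<And>x y. x \<in> E \<Longrightarrow> y \<in> E \<Longrightarrow> inv\<^bsub>H\<^esub> x \<otimes>\<^bsub>H\<^esub> y \<in> L"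
    and \<delta>: "\<delta> > 0"
begin

abbreviation "W \<equiv> wreath_product G H"
abbreviation "N \<equiv> sum_group (carrier H) (\<lambda>_. G)"

section \<open>The two approximations in terms of densities\<close>

lemma s_perm: "g \<in> carrier G \<Longrightarrow> s g permutes A"
  using s by (simp add: sofic_approximation_def)

lemma s_one: "s \<one>\<^bsub>G\<^esub> = id"
  using s by (simp add: sofic_approximation_def)

lemma s_in: "g \<in> carrier G \<Longrightarrow> s g a \<in> A \<longleftrightarrow> a \<in> A"
  by (rule permutes_in_image[OF s_perm])

lemma s_eq: "g \<in> carrier G \<Longrightarrow> s g a = s g a' \<longleftrightarrow> a = a'"
  using permutes_inj[OF s_perm] by (auto dest: injD)

lemma s_mult: "g \<in> K \<Longrightarrow> g' \<in> K \<Longrightarrow> density A (\<lambda>a. s g (s g' a) \<noteq> s (g \<otimes>\<^bsub>G\<^esub> g') a) < \<delta>"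
  using s by (simp add: sofic_approximation_def multiplicative_def hamming_dist_density)

lemma s_free: "g \<in> K \<Longrightarrow> g \<noteq> \<one>\<^bsub>G\<^esub> \<Longrightarrow> density A (\<lambda>a. s g a = a) < \<delta>"
  using s by (fastforce simp: sofic_approximation_def almost_free_def hamming_dist_density
      density_not[OF A])

lemma t_perm: "h \<in> carrier H \<Longrightarrow> t h permutes B"
  using t by (simp add: sofic_approximation_def)

lemma t_one: "t \<one>\<^bsub>H\<^esub> = id"
  using t by (simp add: sofic_approximation_def)

lemma t_in: "h \<in> carrier H \<Longrightarrow> t h b \<in> B \<longleftrightarrow> b \<in> B"
  by (rule permutes_in_image[OF t_perm])

lemma t_eq: "h \<in> carrier H \<Longrightarrow> t h b = t h b' \<longleftrightarrow> b = b'"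
  using permutes_inj[OF t_perm] by (auto dest: injD)

lemma t_surj:
  assumes "h \<in> carrier H" "b \<in> B"
  obtains c where "c \<in> B" "t h c = b"
  using permutes_image[OF t_perm[OF assms(1)]] assms(2) by (metis imageE)

lemma t_mult: "h \<in> L \<Longrightarrow> h' \<in> L \<Longrightarrow> density B (\<lambda>b. t h (t h' b) \<noteq> t (h \<otimes>\<^bsub>H\<^esub> h') b) < \<delta>"
  using t by (simp add: sofic_approximation_def multiplicative_def hamming_dist_density)

lemma t_free: "h \<in> L \<Longrightarrow> h \<noteq> \<one>\<^bsub>H\<^esub> \<Longrightarrow> density B (\<lambda>b. t h b = b) < \<delta>"
  using t by (fastforce simp: sofic_approximation_def almost_free_def hamming_dist_density
      density_not[OF B])

lemma N_in: "f \<in> carrier N \<Longrightarrow> x \<in> carrier H \<Longrightarrow> f x \<in> carrier G"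
  by (auto simp: carrier_sum_group G.is_group PiE_iff)

section \<open>Positions whose lamps are distinct\<close>

text \<open>For \<open>b\<close> in \<open>B\<close> this is injectivity of the map sending
  \<open>x\<close> in \<open>E\<close> to the lamp at the preimage of \<open>b\<close> under
  \<open>t x\<close>, phrased without inverses.\<close>

definition separated :: "'b \<Rightarrow> bool" where
  "separated b \<longleftrightarrow> (\<forall>x\<in>E. \<forall>y\<in>E. \<forall>c\<in>B. t x c = b \<longrightarrow> t y c = b \<longrightarrow> x = y)"

text \<open>Apply \<open>t\<close> of the inverse of \<open>x\<close> to both sides of
  \<open>t x c = t y c\<close>. Unless multiplicativity fails for one of the two products,
  \<open>c\<close> becomes a fixed point of \<open>t\<close> at the nontrivial element
  \<open>inv x \<otimes> y\<close>, which is rare by freeness.\<close>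

lemma density_collision:
  assumes x: "x \<in> E" and y: "y \<in> E" and "x \<noteq> y"
  shows "density B (\<lambda>c. t x c = t y c) \<le> 3 * \<delta>"
proof -
  have [simp]: "x \<in> carrier H" "y \<in> carrier H" using x y E by auto
  let ?P = "\<lambda>c. t (inv\<^bsub>H\<^esub> x) (t x c) \<noteq> t (inv\<^bsub>H\<^esub> x \<otimes>\<^bsub>H\<^esub> x) c"
  let ?Q = "\<lambda>c. t (inv\<^bsub>H\<^esub> x) (t y c) \<noteq> t (inv\<^bsub>H\<^esub> x \<otimes>\<^bsub>H\<^esub> y) c"
  let ?R = "\<lambda>c. t (inv\<^bsub>H\<^esub> x \<otimes>\<^bsub>H\<^esub> y) c = c"
  have "density B (\<lambda>c. t x c = t y c) \<le> density B (\<lambda>c. ?P c \<or> ?Q c \<or> ?R c)"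
    by (rule density_mono[OF B(1)]) (auto simp: t_one)
  also have "\<dots> \<le> density B ?P + (density B ?Q + density B ?R)"
    using density_disj[of B ?P] density_disj[of B ?Q ?R] by (meson add_left_mono order_trans)
  also have "\<dots> \<le> \<delta> + (\<delta> + \<delta>)"
  proof (intro add_mono)
    show "density B ?P \<le> \<delta>" "density B ?Q \<le> \<delta>"
      using x y E inv_E by (intro less_imp_le[OF t_mult]; auto)+
    have "inv\<^bsub>H\<^esub> x \<otimes>\<^bsub>H\<^esub> y \<noteq> \<one>\<^bsub>H\<^esub>"
      using \<open>x \<noteq> y\<close> H.inv_solve_left'[of "\<one>\<^bsub>H\<^esub>" x y] by simp
    then show "density B ?R \<le> \<delta>"
      using inv_E_E[OF x y] by (intro less_imp_le[OF t_free])
  qed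
  finally show ?thesis by simp
qed

lemma density_not_separated:
  "density B (\<lambda>b. \<not> separated b) \<le> 3 * real (card E) ^ 2 * \<delta>"
proof -
  \<comment> \<open>The inequality sits inside the predicate, so diagonal pairs contribute density
    zero and the union bound can run over all of \<open>E \<times> E\<close>.\<close>
  let ?C = "\<lambda>p b. \<exists>c\<in>B. fst p \<noteq> snd p \<and> t (fst p) c = b \<and> t (snd p) c = b"
  have "density B (\<lambda>b. \<not> separated b) \<le> density B (\<lambda>b. \<exists>p\<in>E \<times> E. ?C p b)"
    by (rule density_mono[OF B(1)]) (fastforce simp: separated_def)
  also have "\<dots> \<le> real (card (E \<times> E)) * (3 * \<delta>)"
  proof (rule density_Bex)
    show "finite (E \<times> E)" using E by simp
    fix p assume "p \<in> E \<times> E"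
    then obtain x y where p: "p = (x, y)" and xy: "x \<in> E" "y \<in> E" by auto
    have x: "x \<in> carrier H" using xy E by auto
    show "density B (?C p) \<le> 3 * \<delta>"
    proof (cases "x = y")
      case True
      then show ?thesis using p \<delta> by (simp add: density_def)
    next
      case False
      \<comment> \<open>Substituting \<open>b = t x c\<close> turns the existential witness into the
        variable itself, by injectivity of \<open>t x\<close>.\<close>
      have "density B (?C p) = density B (\<lambda>c. ?C p (t x c))"
        by (rule density_permutes[OF t_perm[OF x], where P = "?C p", symmetric])
      also have "\<dots> \<le> density B (\<lambda>c. t x c = t y c)"
        by (rule density_mono[OF B(1)]) (auto simp: p t_eq[OF x])
      also have "\<dots> \<le> 3 * \<delta>" by (rule density_collision[OF xy False])
      finally show ?thesis .
    qed
  qed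
  finally show ?thesis by (simp add: card_cartesian_product power2_eq_square mult_ac)
qed

text \<open>
  The lamp at \<open>c\<close> is multiplied by \<open>lamp f c b\<close> when the lamplighter stands at \<open>b\<close>.
  The choice of \<open>x\<close> is unambiguous when \<open>b\<close> is separated.
\<close>

definition lamp :: "('h \<Rightarrow> 'g) \<Rightarrow> 'b \<Rightarrow> 'b \<Rightarrow> 'g" where
  "lamp f c b = (if \<exists>x\<in>E. t x c = b then f (SOME x. x \<in> E \<and> t x c = b) else \<one>\<^bsub>G\<^esub>)"

text \<open>The chosen \<open>x\<close> depends only on \<open>c\<close> and \<open>b\<close>, so
  one \<open>x\<close> serves all \<open>f\<close> at once. Hence \<open>lamp\<close> respects
  products of families at every position, separated or not.\<close>

lemma lamp_cases:
  obtains x where "x \<in> E" "t x c = b" "\<And>f. lamp f c b = f x"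
  | "\<not> (\<exists>x\<in>E. t x c = b)" "\<And>f. lamp f c b = \<one>\<^bsub>G\<^esub>"
proof (cases "\<exists>x\<in>E. t x c = b")
  case True
  then have "\<exists>x. x \<in> E \<and> t x c = b" by blast
  from someI_ex[OF this] show ?thesis
    using True by (intro that(1)[of "SOME x. x \<in> E \<and> t x c = b"]) (auto simp: lamp_def)
next
  case False
  then show ?thesis by (intro that(2)) (auto simp: lamp_def)
qed

lemma lamp_in: "f \<in> carrier N \<Longrightarrow> lamp f c b \<in> carrier G"
  by (rule lamp_cases[of c b]) (use E N_in in auto)

lemma lamp_one: "lamp \<one>\<^bsub>N\<^esub> c b = \<one>\<^bsub>G\<^esub>"
  by (rule lamp_cases[of c b]) (use E in auto)

lemma lamp_mult: "lamp (f \<otimes>\<^bsub>N\<^esub> f') c b = lamp f c b \<otimes>\<^bsub>G\<^esub> lamp f' c b"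
  by (rule lamp_cases[of c b]) (use E in auto)

lemma lamp_separated:
  assumes "separated b" "x \<in> E" "c \<in> B" "t x c = b"
  shows "lamp f c b = f x"
  by (rule lamp_cases[of c b]) (use assms in \<open>auto simp: separated_def\<close>)

text \<open>If \<open>x\<close> is in the support of \<open>f\<close> and \<open>t x c = b\<close>,
  then \<open>t\<close> at \<open>h \<otimes> x\<close> sends \<open>c\<close> to
  \<open>t h b\<close>, and the shifted family takes the value \<open>f x\<close> at
  \<open>h \<otimes> x\<close>. Separation at both positions makes these the values that
  \<open>lamp\<close> picks.\<close>

lemma lamp_shift:
  assumes sep: "separated b" "separated (t h b)" and b: "b \<in> B" and h: "h \<in> carrier H"
    and supp: "\<And>x. x \<in> carrier H \<Longrightarrow> f x \<noteq> \<one>\<^bsub>G\<^esub> \<Longrightarrow> x \<in> E \<and> h \<otimes>\<^bsub>H\<^esub> x \<in> E"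
    and mult: "\<And>x c. x \<in> E \<Longrightarrow> h \<otimes>\<^bsub>H\<^esub> x \<in> E \<Longrightarrow> c \<in> B \<Longrightarrow> t x c = b \<Longrightarrow> t (h \<otimes>\<^bsub>H\<^esub> x) c = t h b"
    and c: "c \<in> B"
  shows "lamp (shift_action H h f) c (t h b) = lamp f c b"
proof -
  have shifted: "lamp (shift_action H h f) c (t h b) = lamp f c b"
    if x: "x \<in> carrier H" "f x \<noteq> \<one>\<^bsub>G\<^esub>" "t x c = b" for x
  proof -
    have "lamp (shift_action H h f) c (t h b) = shift_action H h f (h \<otimes>\<^bsub>H\<^esub> x)"
      using supp[OF x(1,2)] mult c x by (intro lamp_separated[OF sep(2)]) auto
    also have "\<dots> = f x"
      using x h by (simp add: shift_action_def H.m_assoc[symmetric])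
    also have "\<dots> = lamp f c b"
      using supp[OF x(1,2)] c x by (intro lamp_separated[OF sep(1), symmetric]) auto
    finally show ?thesis .
  qed
  show ?thesis
  \<comment> \<open>For the remaining lamps both values are trivial. A nontrivial shifted value
    would come from some \<open>y\<close> in the translated support; pulling \<open>y\<close> back
    by \<open>h\<close> gives an \<open>x\<close> in the support of \<open>f\<close>, and
    injectivity of \<open>t y\<close> identifies the lamp belonging to \<open>x\<close> at
    \<open>b\<close> with \<open>c\<close>, the case already settled.\<close>
  proof (rule ccontr)
    assume ne: "\<not> ?thesis"
    then have "\<not> (\<exists>x\<in>carrier H. f x \<noteq> \<one>\<^bsub>G\<^esub> \<and> t x c = b)"
      using shifted by blast
    then have "lamp f c b = \<one>\<^bsub>G\<^esub>"
      by (rule_tac lamp_cases[of c b]) (use E in auto)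
    with ne have "lamp (shift_action H h f) c (t h b) \<noteq> \<one>\<^bsub>G\<^esub>" by simp
    then obtain y where y: "y \<in> E" "t y c = t h b" "shift_action H h f y \<noteq> \<one>\<^bsub>G\<^esub>"
      by (rule_tac lamp_cases[of c "t h b"]) auto
    define x where "x = inv\<^bsub>H\<^esub> h \<otimes>\<^bsub>H\<^esub> y"
    have yH: "y \<in> carrier H" using y E by auto
    have x: "x \<in> carrier H" "h \<otimes>\<^bsub>H\<^esub> x = y"
      using h yH by (auto simp: x_def H.m_assoc[symmetric])
    have fx: "f x \<noteq> \<one>\<^bsub>G\<^esub>" using y yH by (simp add: shift_action_def x_def)
    obtain c' where c': "c' \<in> B" "t x c' = b" using t_surj[OF x(1) b] .
    have "t y c' = t h b" using mult[of x c'] supp[OF x(1) fx] c' x by simp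
    then have "c' = c" using y(2) t_eq[OF yH] by metis
    then show False using shifted[OF x(1) fx] c' ne by simp
  qed
qed

section \<open>Permutations of configurations with a position\<close>

definition points :: "(('b \<Rightarrow> 'a) \<times> 'b) set" where
  "points = (B \<rightarrow>\<^sub>E A) \<times> B"

text \<open>The value \<open>z\<close> outside \<open>points\<close> is what \<open>permutes\<close>
  demands.\<close>

definition lamplighter :: "('h \<Rightarrow> 'g) \<times> 'h \<Rightarrow> ('b \<Rightarrow> 'a) \<times> 'b \<Rightarrow> ('b \<Rightarrow> 'a) \<times> 'b" where
  "lamplighter w z = (if z \<in> points
     then (\<lambda>c\<in>B. s (lamp (fst w) c (t (snd w) (snd z))) (fst z c), t (snd w) (snd z)) else z)"

lemma carrier_W: "carrier W = carrier N \<times> carrier H"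
  by (simp add: wreath_product_def semidirect_product_def)

lemma mult_W: "(f, h) \<otimes>\<^bsub>W\<^esub> (f', h') = (f \<otimes>\<^bsub>N\<^esub> shift_action H h f', h \<otimes>\<^bsub>H\<^esub> h')"
  by (simp add: wreath_product_def semidirect_product_def)

lemma one_W: "\<one>\<^bsub>W\<^esub> = (\<one>\<^bsub>N\<^esub>, \<one>\<^bsub>H\<^esub>)"
  by (simp add: wreath_product_def semidirect_product_def)

lemma finite_points: "finite points" and points_nonempty: "points \<noteq> {}"
  using A B by (auto simp: points_def finite_PiE PiE_eq_empty_iff)

lemma lamplighter_in:
  assumes "w \<in> carrier W" "z \<in> points"
  shows "lamplighter w z \<in> points"
  using assms by (auto simp: lamplighter_def points_def carrier_W t_in s_in lamp_in)

text \<open>The old position is recovered through injectivity of \<open>t\<close>, then each lamp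
  separately through injectivity of \<open>s\<close>; finiteness of \<open>points\<close> gives
  surjectivity.\<close>

lemma lamplighter_permutes:
  assumes w: "w \<in> carrier W"
  shows "lamplighter w permutes points"
proof (rule bij_imp_permutes)
  have fh: "fst w \<in> carrier N" "snd w \<in> carrier H" using w by (auto simp: carrier_W)
  have "inj_on (lamplighter w) points"
  proof (rule inj_onI)
    fix z z' assume z: "z \<in> points" "z' \<in> points" and eq: "lamplighter w z = lamplighter w z'"
    have snd_eq: "snd z = snd z'"
      using eq z t_eq[OF fh(2)] by (simp add: lamplighter_def)
    have "fst z c = fst z' c" if "c \<in> B" for c
    proof -
      have "fst (lamplighter w z) c = fst (lamplighter w z') c" using eq by simp
      then show ?thesis
        using z that snd_eq s_eq[OF lamp_in[OF fh(1)]] by (simp add: lamplighter_def)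
    qed
    then have "fst z = fst z'"
      using z by (intro PiE_ext[of _ B "\<lambda>_. A"]) (auto simp: points_def)
    with snd_eq show "z = z'" by (simp add: prod_eq_iff)
  qed
  moreover have "lamplighter w ` points \<subseteq> points"
    using lamplighter_in[OF w] by blast
  ultimately show "bij_betw (lamplighter w) points points"
    unfolding bij_betw_def using endo_inj_surj[OF finite_points] by blast
qed (simp add: lamplighter_def)

lemma lamplighter_one: "lamplighter \<one>\<^bsub>W\<^esub> = id"
proof
  fix z :: "('b \<Rightarrow> 'a) \<times> 'b"
  have "(\<lambda>c\<in>B. fst z c) = fst z" if "z \<in> points"
    using that by (auto simp: points_def PiE_iff intro: extensional_restrict)
  then show "lamplighter \<one>\<^bsub>W\<^esub> z = id z"
    by (simp add: lamplighter_def one_W lamp_one s_one t_one del: one_sum_group)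
qed

section \<open>Multiplicativity and freeness estimates\<close>

text \<open>A starting position is bad if the two routes end at different positions (cost \<delta>),
  if one of the two later positions is not separated (\<open>3 * card E ^ 2 * \<delta>\<close>
  each), or if left translation by \<open>h\<close> fails for a lamp in the window
  (\<open>card E * \<delta>\<close>). At a good position at most \<open>card E\<close> lamps can
  show an error of \<open>s\<close>, each with density below \<delta>.\<close>

lemma lamplighter_multiplicative:
  assumes w: "(f, h) \<in> carrier W" "(f', h') \<in> carrier W" and hL: "h \<in> L" "h' \<in> L"
    and supp: "\<And>x. x \<in> carrier H \<Longrightarrow> f' x \<noteq> \<one>\<^bsub>G\<^esub> \<Longrightarrow> x \<in> E \<and> h \<otimes>\<^bsub>H\<^esub> x \<in> E"
    and K: "\<one>\<^bsub>G\<^esub> \<in> K" "f ` E \<subseteq> K" "f' ` E \<subseteq> K"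
  shows "hamming_dist points (lamplighter (f, h) \<circ> lamplighter (f', h'))
      (lamplighter ((f, h) \<otimes>\<^bsub>W\<^esub> (f', h'))) \<le> (1 + 2 * real (card E) + 6 * real (card E) ^ 2) * \<delta>"
proof -
  have f: "f \<in> carrier N" "f' \<in> carrier N" and h: "h \<in> carrier H" "h' \<in> carrier H"
    using w by (auto simp: carrier_W)
  let ?M = "\<lambda>b. t h (t h' b) \<noteq> t (h \<otimes>\<^bsub>H\<^esub> h') b"
  let ?S1 = "\<lambda>b. \<not> separated (t h' b)"
  let ?S2 = "\<lambda>b. \<not> separated (t h (t h' b))"
  \<comment> \<open>This is the failure of the hypothesis \<open>mult\<close> of
    \<open>lamp_shift\<close> for \<open>x\<close>; it is needed at the intermediate position
    \<open>t h' b\<close>.\<close>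
  let ?C = "\<lambda>x b. \<exists>c\<in>B. t x c = b \<and> t h (t x c) \<noteq> t (h \<otimes>\<^bsub>H\<^esub> x) c"
  let ?X = "\<lambda>b. \<exists>x\<in>E. ?C x (t h' b)"
  let ?Bad = "\<lambda>b. ?M b \<or> ?S1 b \<or> ?S2 b \<or> ?X b"
  let ?l = "\<lambda>z. (lamplighter (f, h) \<circ> lamplighter (f', h')) z"
  let ?r = "\<lambda>z. lamplighter ((f, h) \<otimes>\<^bsub>W\<^esub> (f', h')) z"
  have dX: "density B ?X \<le> real (card E) * \<delta>"
  proof -
    have "density B ?X = density B (\<lambda>b. \<exists>x\<in>E. ?C x b)"
      by (rule density_permutes[OF t_perm[OF h(2)], where P = "\<lambda>b. \<exists>x\<in>E. ?C x b"])
    also have "\<dots> \<le> real (card E) * \<delta>"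
    proof (rule density_Bex[OF E(1)])
      fix x assume x: "x \<in> E"
      then have xH: "x \<in> carrier H" using E by auto
      have "density B (?C x) = density B (\<lambda>c. ?C x (t x c))"
        by (rule density_permutes[OF t_perm[OF xH], where P = "?C x", symmetric])
      also have "\<dots> \<le> density B (\<lambda>c. t h (t x c) \<noteq> t (h \<otimes>\<^bsub>H\<^esub> x) c)"
        by (rule density_mono[OF B(1)]) (auto simp: t_eq[OF xH])
      also have "\<dots> \<le> \<delta>"
        using x E hL by (intro less_imp_le[OF t_mult]) auto
      finally show "density B (?C x) \<le> \<delta>" .
    qed
    finally show ?thesis .
  qed
  have dS1: "density B ?S1 \<le> 3 * real (card E) ^ 2 * \<delta>"
    using density_not_separated density_permutes[OF t_perm[OF h(2)], of "\<lambda>b. \<not> separated b"] by simp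
  have dS2: "density B ?S2 \<le> 3 * real (card E) ^ 2 * \<delta>"
    using density_not_separated density_permutes[OF t_perm[OF h(1)], of "\<lambda>b. \<not> separated b"]
      density_permutes[OF t_perm[OF h(2)], of "\<lambda>b. \<not> separated (t h b)"] by simp
  have dM: "density B ?M \<le> \<delta>"
    using t_mult[OF hL] by simp
  have dBad: "density B ?Bad \<le> \<delta> + (3 * real (card E) ^ 2 * \<delta> + (3 * real (card E) ^ 2 * \<delta> + real (card E) * \<delta>))"
    using density_disj[of B ?M "\<lambda>b. ?S1 b \<or> ?S2 b \<or> ?X b"] density_disj[of B ?S1 "\<lambda>b. ?S2 b \<or> ?X b"]
      density_disj[of B ?S2 ?X] dX dS1 dS2 dM by linarith
  have le: "density (B \<rightarrow>\<^sub>E A) (\<lambda>a. ?l (a, b) \<noteq> ?r (a, b)) \<le> real (card E) * \<delta>"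
    if b: "b \<in> B" and good: "\<not> ?Bad b" for b
  proof -
    \<comment> \<open>\<open>b1\<close> and \<open>b2\<close> are the successive positions;
      \<open>g2 c\<close> and then \<open>g1 c\<close> act on the lamp at \<open>c\<close>. The
      product acts there by \<open>g1 c \<otimes> g2 c\<close>, once \<open>lamp_shift\<close>
      identifies its second factor.\<close>
    define b1 b2 where "b1 = t h' b" and "b2 = t h b1"
    define g1 g2 where "g1 c = lamp f c b2" and "g2 c = lamp f' c b1" for c
    have b1: "b1 \<in> B" using b h by (simp add: b1_def t_in)
    have "t h (t h' b) = t (h \<otimes>\<^bsub>H\<^esub> h') b" using good by blast
    then have b2: "t (h \<otimes>\<^bsub>H\<^esub> h') b = b2" by (simp add: b1_def b2_def)
    have sep: "separated b1" "separated (t h b1)" unfolding b1_def using good by blast+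
    have good_mult: "t (h \<otimes>\<^bsub>H\<^esub> x) c = t h b1" if "x \<in> E" "c \<in> B" "t x c = b1" for x c
      using good that unfolding b1_def by force
    have g: "g1 c \<in> carrier G" "g2 c \<in> carrier G" for c
      using f by (auto simp: g1_def g2_def lamp_in)
    have gK: "g1 c \<in> K" "g2 c \<in> K" for c
      unfolding g1_def g2_def by (rule lamp_cases[of c b2], use K in auto)
        (rule lamp_cases[of c b1], use K in auto)
    have shift: "lamp (shift_action H h f') c b2 = g2 c" if "c \<in> B" for c
      unfolding b2_def g2_def
      by (rule lamp_shift[OF sep b1 h(1) supp good_mult that])
    \<comment> \<open>The lamps within reach of \<open>b2\<close>. Their number is bounded by
      \<open>card E\<close>, independently of the size of \<open>B\<close>.\<close>
    define C where "C = (\<lambda>x. inv_into UNIV (t x) b2) ` E"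
    have C: "c \<in> C" if "x \<in> E" "t x c = b2" for x c
    proof -
      have "inj (t x)" using that E t_perm permutes_inj by blast
      then have "inv_into UNIV (t x) b2 = c" using that(2) by (metis inv_f_f)
      then show ?thesis using that(1) by (auto simp: C_def)
    qed
    let ?D = "\<lambda>c a. s (g1 c) (s (g2 c) (a c)) \<noteq> s (g1 c \<otimes>\<^bsub>G\<^esub> g2 c) (a c)"
    have "density (B \<rightarrow>\<^sub>E A) (\<lambda>a. ?l (a, b) \<noteq> ?r (a, b)) \<le> density (B \<rightarrow>\<^sub>E A) (\<lambda>a. \<exists>c\<in>C \<inter> B. ?D c a)"
    proof (rule density_mono)
      show "finite (B \<rightarrow>\<^sub>E A)" using A B by (simp add: finite_PiE)
      fix a assume a: "a \<in> B \<rightarrow>\<^sub>E A" and ne: "?l (a, b) \<noteq> ?r (a, b)"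
      have ab: "(a, b) \<in> points" using a b by (simp add: points_def)
      have l: "?l (a, b) = (\<lambda>c\<in>B. s (g1 c) (s (g2 c) (a c)), b2)"
      proof -
        have eq: "lamplighter (f', h') (a, b) = (\<lambda>c\<in>B. s (g2 c) (a c), b1)"
          using ab by (simp add: lamplighter_def b1_def g2_def)
        have "lamplighter (f, h) (\<lambda>c\<in>B. s (g2 c) (a c), b1) =
            (\<lambda>c\<in>B. s (g1 c) ((\<lambda>c\<in>B. s (g2 c) (a c)) c), b2)"
          using lamplighter_in[OF w(2) ab, unfolded eq] by (simp add: lamplighter_def b2_def g1_def)
        also have "\<dots> = (\<lambda>c\<in>B. s (g1 c) (s (g2 c) (a c)), b2)"
          by (simp cong: restrict_cong)
        finally show ?thesis by (simp add: eq)
      qed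
      have r: "?r (a, b) = (\<lambda>c\<in>B. s (g1 c \<otimes>\<^bsub>G\<^esub> g2 c) (a c), b2)"
        using ab by (simp add: lamplighter_def mult_W b2 lamp_mult shift g1_def
            del: mult_sum_group cong: restrict_cong)
      have "\<exists>c\<in>B. ?D c a"
      proof (rule ccontr)
        assume "\<not> ?thesis"
        then have "(\<lambda>c\<in>B. s (g1 c) (s (g2 c) (a c))) = (\<lambda>c\<in>B. s (g1 c \<otimes>\<^bsub>G\<^esub> g2 c) (a c))"
          by (intro restrict_ext) blast
        with ne show False unfolding l r by simp
      qed
      then obtain c where c: "c \<in> B" "?D c a" by blast
      \<comment> \<open>Beyond reach of \<open>b2\<close> the factor \<open>g1 c\<close> is trivial,
        and since \<open>s\<close> sends the unit to the identity exactly, both sides agree there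
        without error.\<close>
      have "c \<in> C"
      proof (rule lamp_cases[of c b2])
        assume "\<And>k. lamp k c b2 = \<one>\<^bsub>G\<^esub>"
        with c(2) g(2)[of c] show ?thesis by (simp add: g1_def s_one)
      qed (rule C)
      with c show "\<exists>c\<in>C \<inter> B. ?D c a" by blast
    qed
    also have "\<dots> \<le> real (card (C \<inter> B)) * \<delta>"
    proof (rule density_Bex)
      show "finite (C \<inter> B)" using B by simp
      fix c assume "c \<in> C \<inter> B"
      then have "density (B \<rightarrow>\<^sub>E A) (?D c) = density A (\<lambda>x. s (g1 c) (s (g2 c) x) \<noteq> s (g1 c \<otimes>\<^bsub>G\<^esub> g2 c) x)"
        using A B by (intro density_PiE[where P = "\<lambda>x. s (g1 c) (s (g2 c) x) \<noteq> s (g1 c \<otimes>\<^bsub>G\<^esub> g2 c) x"]) auto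
      also have "\<dots> \<le> \<delta>" by (rule less_imp_le[OF s_mult[OF gK]])
      finally show "density (B \<rightarrow>\<^sub>E A) (?D c) \<le> \<delta>" .
    qed
    also have "\<dots> \<le> real (card E) * \<delta>"
    proof -
      have "card (C \<inter> B) \<le> card C" using E by (intro card_mono) (auto simp: C_def)
      also have "\<dots> \<le> card E" unfolding C_def by (rule card_image_le[OF E(1)])
      finally show ?thesis using \<delta> by (simp add: mult_right_mono)
    qed
    finally show ?thesis .
  qed
  have "density ((B \<rightarrow>\<^sub>E A) \<times> B) (\<lambda>z. ?l z \<noteq> ?r z) \<le> density B ?Bad + real (card E) * \<delta>"
  proof (rule density_Times_le[where Bad = ?Bad and R = "\<lambda>z. ?l z \<noteq> ?r z"])
    show "finite (B \<rightarrow>\<^sub>E A)" "(B \<rightarrow>\<^sub>E A) \<noteq> {}" "0 \<le> real (card E) * \<delta>"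
      using A B \<delta> by (auto simp: finite_PiE PiE_eq_empty_iff)
  qed (fact B le)+
  then have "density points (\<lambda>z. ?l z \<noteq> ?r z) \<le> density B ?Bad + real (card E) * \<delta>"
    by (simp add: points_def)
  also have "\<dots> \<le> (1 + 2 * real (card E) + 6 * real (card E) ^ 2) * \<delta>"
    using dBad by (simp add: algebra_simps)
  finally show ?thesis by (simp add: hamming_dist_density)
qed

text \<open>If \<open>h\<close> is nontrivial, the position moves for most \<open>b\<close>.
  Otherwise some \<open>f x\<close> is nontrivial, and at a separated \<open>b\<close> the lamp
  reached through \<open>x\<close> is moved by \<open>s (f x)\<close>, which has few fixed
  points.\<close>

lemma lamplighter_free:
  assumes w: "(f, h) \<in> carrier W" "(f, h) \<noteq> \<one>\<^bsub>W\<^esub>" and hL: "h \<in> L"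
    and supp: "\<And>x. x \<in> carrier H \<Longrightarrow> f x \<noteq> \<one>\<^bsub>G\<^esub> \<Longrightarrow> x \<in> E" and K: "f ` E \<subseteq> K"
  shows "hamming_dist points (lamplighter (f, h)) id \<ge> 1 - (1 + 3 * real (card E) ^ 2) * \<delta>"
proof -
  have f: "f \<in> carrier N" and h: "h \<in> carrier H"
    using w by (auto simp: carrier_W)
  have PiE: "finite (B \<rightarrow>\<^sub>E A)" "(B \<rightarrow>\<^sub>E A) \<noteq> {}"
    using A B by (auto simp: finite_PiE PiE_eq_empty_iff)
  have "density ((B \<rightarrow>\<^sub>E A) \<times> B) (\<lambda>z. lamplighter (f, h) z = z) \<le> (1 + 3 * real (card E) ^ 2) * \<delta>"
  proof (cases "h = \<one>\<^bsub>H\<^esub>")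
    case False
    have "density ((B \<rightarrow>\<^sub>E A) \<times> B) (\<lambda>z. lamplighter (f, h) z = z) \<le> density B (\<lambda>b. t h b = b) + 0"
    proof (rule density_Times_le[OF PiE B])
      fix b assume "b \<in> B" "t h b \<noteq> b"
      then have "{a \<in> B \<rightarrow>\<^sub>E A. lamplighter (f, h) (a, b) = (a, b)} = {}"
        by (auto simp: lamplighter_def points_def)
      then show "density (B \<rightarrow>\<^sub>E A) (\<lambda>a. lamplighter (f, h) (a, b) = (a, b)) \<le> 0"
        unfolding density_def by (simp only: card.empty)
    qed simp
    also have "\<dots> \<le> \<delta>" using t_free[OF hL False] by simp
    also have "\<dots> \<le> (1 + 3 * real (card E) ^ 2) * \<delta>" using \<delta> by simp
    finally show ?thesis .
  next
    case True
    have "\<exists>x\<in>carrier H. f x \<noteq> \<one>\<^bsub>G\<^esub>"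
    proof (rule ccontr)
      assume "\<not> ?thesis"
      then have "f = \<one>\<^bsub>N\<^esub>"
        using f by (auto simp: carrier_sum_group G.is_group PiE_iff extensional_def)
      then show False using w True by (simp add: one_W)
    qed
    then obtain x where xH: "x \<in> carrier H" and fx: "f x \<noteq> \<one>\<^bsub>G\<^esub>" by blast
    have x: "x \<in> E" using supp xH fx by blast
    have "density ((B \<rightarrow>\<^sub>E A) \<times> B) (\<lambda>z. lamplighter (f, h) z = z)
        \<le> density B (\<lambda>b. \<not> separated b) + \<delta>"
    proof (rule density_Times_le[OF PiE B])
      fix b assume b: "b \<in> B" and "\<not> \<not> separated b"
      then have sep: "separated b" by simp
      obtain c where c: "c \<in> B" "t x c = b" using t_surj[OF xH b] .
      have "density (B \<rightarrow>\<^sub>E A) (\<lambda>a. lamplighter (f, h) (a, b) = (a, b))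
          \<le> density (B \<rightarrow>\<^sub>E A) (\<lambda>a. s (f x) (a c) = a c)"
      proof (rule density_mono[OF PiE(1)])
        fix a assume a: "a \<in> B \<rightarrow>\<^sub>E A" and "lamplighter (f, h) (a, b) = (a, b)"
        then have "fst (lamplighter (f, h) (a, b)) c = a c" by simp
        then show "s (f x) (a c) = a c"
          using a b c True lamp_separated[OF sep x c]
          by (simp add: lamplighter_def points_def t_one)
      qed
      also have "\<dots> = density A (\<lambda>y. s (f x) y = y)"
        using A B c by (intro density_PiE[where P = "\<lambda>y. s (f x) y = y"]) auto
      also have "\<dots> \<le> \<delta>"
        using x K fx by (intro less_imp_le[OF s_free]) auto
      finally show "density (B \<rightarrow>\<^sub>E A) (\<lambda>a. lamplighter (f, h) (a, b) = (a, b)) \<le> \<delta>" .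
    qed (use \<delta> in simp)
    also have "\<dots> \<le> (1 + 3 * real (card E) ^ 2) * \<delta>"
      using density_not_separated by (simp add: algebra_simps)
    finally show ?thesis .
  qed
  then have "density points (\<lambda>z. lamplighter (f, h) z = z) \<le> (1 + 3 * real (card E) ^ 2) * \<delta>"
    by (simp only: points_def)
  then show ?thesis
    by (simp add: hamming_dist_density density_not[OF finite_points points_nonempty])
qed

end

section \<open>Choice of the parameters\<close>

theorem theorem1:
  fixes G :: "('g, 'k) monoid_scheme" and H :: "('h, 'm) monoid_scheme"
  assumes "group G" and "countable (carrier G)" and "sofic G"
    and "group H" and "countable (carrier H)" and "sofic H"
  shows "sofic (wreath_product G H)"
proof (rule soficI[OF group_wreath_product[OF assms(1,4)]])
  interpret G: group G by fact
  interpret H: group H by fact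
  let ?W = "wreath_product G H"
  fix F :: "(('h \<Rightarrow> 'g) \<times> 'h) set" and \<epsilon> :: real
  assume F: "finite F" "F \<subseteq> carrier ?W" and \<epsilon>: "\<epsilon> > 0"
  have F_mem: "fst w \<in> carrier (sum_group (carrier H) (\<lambda>_. G))" "snd w \<in> carrier H"
    if "w \<in> F" for w
    using F that by (auto simp: wreath_product_def semidirect_product_def)
  define S where "S = (\<Union>w\<in>F. {x \<in> carrier H. fst w x \<noteq> \<one>\<^bsub>G\<^esub>})"
  define P where "P = insert \<one>\<^bsub>H\<^esub> (snd ` F)"
  \<comment> \<open>Since \<open>P\<close> contains the unit, \<open>E\<close> contains every
    support occurring in \<open>F\<close> as well as its translates by the
    \<open>H\<close>-components of \<open>F\<close>.\<close>
  define E where "E = (\<lambda>(h, x). h \<otimes>\<^bsub>H\<^esub> x) ` (P \<times> S)"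
  \<comment> \<open>The unit is included because \<open>lamp\<close> takes this value at lamps out
    of reach.\<close>
  define K where "K = insert \<one>\<^bsub>G\<^esub> ((\<lambda>(w, x). fst w x) ` (F \<times> E))"
  define L where "L = P \<union> E \<union> (\<lambda>x. inv\<^bsub>H\<^esub> x) ` E \<union> (\<lambda>(x, y). inv\<^bsub>H\<^esub> x \<otimes>\<^bsub>H\<^esub> y) ` (E \<times> E)"
  define n where "n = real (card E)"
  \<comment> \<open>The denominator exceeds both error constants,
    \<open>1 + 2 * n + 6 * n ^ 2\<close> and \<open>1 + 3 * n ^ 2\<close>, so the weak estimates
    become strict bounds by \<epsilon>.\<close>
  define \<delta> where "\<delta> = \<epsilon> / (2 + 2 * n + 6 * n ^ 2)"
  have "finite S"
    unfolding S_def using F(1) F_mem(1) by (auto simp: carrier_sum_group assms(1))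
  then have fin: "finite E" "finite P"
    using F(1) by (auto simp: E_def P_def)
  then have fin': "finite K" "finite L"
    using F(1) by (auto simp: K_def L_def)
  have S: "S \<subseteq> carrier H" by (auto simp: S_def)
  have P: "P \<subseteq> carrier H" using F_mem(2) by (auto simp: P_def)
  have EH: "E \<subseteq> carrier H" using S P by (auto simp: E_def)
  have LH: "L \<subseteq> carrier H" using P EH by (auto simp: L_def)
  have KG: "K \<subseteq> carrier G"
    using F_mem(1) EH by (fastforce simp: K_def carrier_sum_group assms(1) PiE_iff)
  have n: "n \<ge> 0" by (simp add: n_def)
  have den: "2 + 2 * n + 6 * n ^ 2 > 0" using n by (simp add: add_pos_nonneg)
  have \<delta>: "\<delta> > 0" using \<epsilon> den by (simp add: \<delta>_def)
  have \<epsilon>_eq: "\<epsilon> = (2 + 2 * n + 6 * n ^ 2) * \<delta>" using den by (simp add: \<delta>_def)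
  have mult_less: "(1 + 2 * n + 6 * n ^ 2) * \<delta> < \<epsilon>"
    unfolding \<epsilon>_eq using \<delta> by (intro mult_strict_right_mono) auto
  have free_less: "(1 + 3 * n ^ 2) * \<delta> < \<epsilon>"
    unfolding \<epsilon>_eq using n zero_le_power2[of n] by (intro mult_strict_right_mono[OF _ \<delta>]) linarith
  obtain A :: "nat set" and s where A: "finite A" "A \<noteq> {}" "sofic_approximation G K \<delta> A s"
    using assms(3)[unfolded sofic_def, rule_format, of K \<delta>] fin'(1) KG \<delta> by blast
  obtain B :: "nat set" and t where B: "finite B" "B \<noteq> {}" "sofic_approximation H L \<delta> B t"
    using assms(6)[unfolded sofic_def, rule_format, of L \<delta>] fin'(2) LH \<delta> by blast
  interpret wreath_approximation G H A B s t K L E \<delta>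
    by unfold_locales (use A B fin(1) EH \<delta> in \<open>auto simp: L_def\<close>)
  \<comment> \<open>Here \<open>h\<close> ranges over all of \<open>P\<close>: in a product, the
    support of one element is translated by the \<open>H\<close>-component of the other.\<close>
  have shifted: "h \<otimes>\<^bsub>H\<^esub> x \<in> E" if "w \<in> F" "x \<in> carrier H" "fst w x \<noteq> \<one>\<^bsub>G\<^esub>" "h \<in> P" for w x h
    using that by (auto simp: E_def S_def intro!: image_eqI[of _ _ "(h, x)"])
  have supp: "x \<in> E" if "w \<in> F" "x \<in> carrier H" "fst w x \<noteq> \<one>\<^bsub>G\<^esub>" for w x
    using shifted[OF that, of "\<one>\<^bsub>H\<^esub>"] that(2) by (simp add: P_def)
  have inP: "snd w \<in> P" if "w \<in> F" for w using that by (simp add: P_def)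
  have inL: "snd w \<in> L" if "w \<in> F" for w using inP[OF that] by (simp add: L_def)
  have inK: "fst w ` E \<subseteq> K" if "w \<in> F" for w using that by (force simp: K_def)
  have "multiplicative ?W F \<epsilon> points lamplighter"
    unfolding multiplicative_def
  proof (intro ballI)
    fix w w' assume w: "w \<in> F" "w' \<in> F"
    have "hamming_dist points (lamplighter (fst w, snd w) \<circ> lamplighter (fst w', snd w'))
      (lamplighter ((fst w, snd w) \<otimes>\<^bsub>?W\<^esub> (fst w', snd w'))) \<le> (1 + 2 * real (card E) + 6 * real (card E) ^ 2) * \<delta>"
    proof (rule lamplighter_multiplicative)
      show "(fst w, snd w) \<in> carrier ?W" "(fst w', snd w') \<in> carrier ?W" using w F by auto
      show "x \<in> E \<and> snd w \<otimes>\<^bsub>H\<^esub> x \<in> E" if "x \<in> carrier H" "fst w' x \<noteq> \<one>\<^bsub>G\<^esub>" for x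
        using supp[OF w(2) that] shifted[OF w(2) that inP[OF w(1)]] by simp
      show "\<one>\<^bsub>G\<^esub> \<in> K" by (simp add: K_def)
    qed (use w in \<open>simp_all only: inL inK\<close>)
    with mult_less show "hamming_dist points (lamplighter w \<circ> lamplighter w')
        (lamplighter (w \<otimes>\<^bsub>?W\<^esub> w')) < \<epsilon>"
      by (simp add: n_def)
  qed
  moreover have "almost_free ?W F \<epsilon> points lamplighter"
    unfolding almost_free_def
  proof (intro ballI)
    fix w assume w: "w \<in> F - {\<one>\<^bsub>?W\<^esub>}"
    have "hamming_dist points (lamplighter (fst w, snd w)) id \<ge> 1 - (1 + 3 * real (card E) ^ 2) * \<delta>"
    proof (rule lamplighter_free)
      show "(fst w, snd w) \<in> carrier ?W" "(fst w, snd w) \<noteq> \<one>\<^bsub>?W\<^esub>" using w F by auto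
      show "x \<in> E" if "x \<in> carrier H" "fst w x \<noteq> \<one>\<^bsub>G\<^esub>" for x
        using supp[of w x] w that by blast
      show "snd w \<in> L" "fst w ` E \<subseteq> K" using w inL inK by blast+
    qed
    with free_less show "hamming_dist points (lamplighter w) id > 1 - \<epsilon>"
      by (simp add: n_def)
  qed
  ultimately have "sofic_approximation ?W F \<epsilon> points lamplighter"
    unfolding sofic_approximation_def
    using lamplighter_permutes lamplighter_one by blast
  then show "\<exists>(Z :: ((nat \<Rightarrow> nat) \<times> nat) set) \<sigma>.
      finite Z \<and> Z \<noteq> {} \<and> sofic_approximation ?W F \<epsilon> Z \<sigma>"
    using finite_points points_nonempty by blast
qed

end
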